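(* Let $\mathcal{A}$ be a variety of $\Omega$-groups and let $\mathcal{B}=\mathcal{A}_{\mathsf{Ab}}$ be the subvariety of all abelian $\Omega$-groups in $\mathcal{A}$. Then for every $A\in\mathcal{A}$ and all ideals $M,N$ of $A$, the relative commutator $[M,N]_{\mathcal{A}_{\mathsf{Ab}}}$ equals Higgins's commutator $[M,N]$.
   Context: A variety of $\Omega$-groups is a variety of universal algebras which has amongst its operations and identities those of the variety of groups but has no more than one constant (the unit $1$); thus $\{1\}$ is a subalgebra of every algebra, i.e. every operation $\omega$ satisfies $\omega(1,\dots,1)=1$. Its algebras are called $\Omega$-groups. An ideal of an $\Omega$-group $A$ is a subalgebra of $A$ that is the kernel of some homomorphism $A\to B$ in $\mathcal{A}$. For subalgebras $M,N$ of $A$, $M\vee N$ is the subalgebra generated by $M\cup N$ and $M\wedge N$ is the intersection. Bold letters denote finite tuples; for tuples $\mathbf{x}=(x_1,\dots,x_r)$, $\mathbf{y}=(y_1,\dots,y_r)$ write $\mathbf{x}\mathbf{y}=(x_1y_1,\dots,x_ry_r)$, and $\mathbf{m}\in M$ means that all entries of $\mathbf{m}$ lie in $M$. For a subvariety $\mathcal{B}\le\mathcal{A}$, let $W=W_{\mathcal{B}}=\{v(\mathbf{x}) \mid v(\mathbf{b})=1 \text{ for all } B\in\mathcal{B} \text{ and all } \mathbf{b}\in B\}$, a set of terms, i.e. of elements of the free $\Omega$-group $F_{\mathcal{A}}(\mathbb{N})$ of $\mathcal{A}$ on a countable set. For $A\in\mathcal{A}$ and ideals $M,N$ of $A$, the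 commutator $[M,N]_{\mathcal{B}}$ is the ideal of $M\vee N$ generated by the set $$\{v(\mathbf{m}\mathbf{n})v(\mathbf{n})^{-1}v(\mathbf{m})^{-1},\ v(\mathbf{p}) \mid v\in W,\ \mathbf{m}\in M,\ \mathbf{n}\in N,\ \mathbf{p}\in M\wedge N\}.$$ An algebra $A\in\mathcal{A}$ is abelian if it can be endowed with an internal group structure; for $\Omega$-groups this holds if and only if the group operation on $A$ is a homomorphism $A\times A\to A$ in $\mathcal{A}$. $\mathcal{A}_{\mathsf{Ab}}$ is the subvariety of all abelian algebras of $\mathcal{A}$. Higgins's commutator $[M,N]$ of two ideals $M,N$ of $A$ is the ideal of $M\vee N$ generated by the set $\{f(\mathbf{m}\mathbf{n})f(\mathbf{n})^{-1}f(\mathbf{m})^{-1} \mid f \text{ a term},\ \mathbf{m}\in M,\ \mathbf{n}\in N\}$. *)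

theory Defs
  imports "HOL-Algebra.Group"
begin

section \<open>Universal algebra\<close>

text \<open>
  A signature is a type \<open>'f\<close> of operation symbols with an arity function \<open>ar :: 'f \<Rightarrow> nat\<close>.
  Only the values of \<^term>\<open>interp A f xs\<close> with \<open>length xs = ar f\<close> and \<open>xs\<close> in the carrier matter.
\<close>

record ('a, 'f) algebra = "'a partial_object" +
  interp :: "'f \<Rightarrow> 'a list \<Rightarrow> 'a"

datatype 'f trm = Var nat | App 'f "'f trm list"

fun wf_trm :: "('f \<Rightarrow> nat) \<Rightarrow> 'f trm \<Rightarrow> bool" where
  "wf_trm ar (Var i) \<longleftrightarrow> True"
| "wf_trm ar (App f ts) \<longleftrightarrow> length ts = ar f \<and> (\<forall>t \<in> set ts. wf_trm ar t)"

primrec eval_trm :: "('a, 'f) algebra \<Rightarrow> (nat \<Rightarrow> 'a) \<Rightarrow> 'f trm \<Rightarrow> 'a" where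
  "eval_trm A \<rho> (Var i) = \<rho> i"
| "eval_trm A \<rho> (App f ts) = interp A f (map (eval_trm A \<rho>) ts)"

definition closed_under :: "('f \<Rightarrow> nat) \<Rightarrow> ('a, 'f) algebra \<Rightarrow> 'a set \<Rightarrow> bool" where
  "closed_under ar A S \<longleftrightarrow>
     (\<forall>f xs. length xs = ar f \<longrightarrow> set xs \<subseteq> S \<longrightarrow> interp A f xs \<in> S)"

text \<open>The class of algebras (with elements in \<open>'a\<close>) defined by a set of identities.\<close>

definition Mod :: "('f \<Rightarrow> nat) \<Rightarrow> ('f trm \<times> 'f trm) set \<Rightarrow> ('a, 'f) algebra set" where
  "Mod ar E = {A. closed_under ar A (carrier A) \<and>
     (\<forall>(s, t) \<in> E. \<forall>\<rho>. range \<rho> \<subseteq> carrier A \<longrightarrow> eval_trm A \<rho> s = eval_trm A \<rho> t)}"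

definition alg_hom :: "('f \<Rightarrow> nat) \<Rightarrow> ('a, 'f) algebra \<Rightarrow> ('b, 'f) algebra \<Rightarrow> ('a \<Rightarrow> 'b) set" where
  "alg_hom ar A B = {h \<in> carrier A \<rightarrow> carrier B.
     \<forall>f xs. length xs = ar f \<longrightarrow> set xs \<subseteq> carrier A \<longrightarrow>
       h (interp A f xs) = interp B f (map h xs)}"

definition subalgebra :: "('f \<Rightarrow> nat) \<Rightarrow> ('a, 'f) algebra \<Rightarrow> 'a set \<Rightarrow> bool" where
  "subalgebra ar A S \<longleftrightarrow> S \<subseteq> carrier A \<and> closed_under ar A S"

definition restrict_alg :: "('a, 'f) algebra \<Rightarrow> 'a set \<Rightarrow> ('a, 'f) algebra" where
  "restrict_alg A S = A\<lparr>carrier := S\<rparr>"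

definition subalg_gen :: "('f \<Rightarrow> nat) \<Rightarrow> ('a, 'f) algebra \<Rightarrow> 'a set \<Rightarrow> 'a set" where
  "subalg_gen ar A S = \<Inter>{T. subalgebra ar A T \<and> S \<subseteq> T}"

definition prod_alg :: "('a, 'f) algebra \<Rightarrow> ('b, 'f) algebra \<Rightarrow> ('a \<times> 'b, 'f) algebra" where
  "prod_alg A B = \<lparr>carrier = carrier A \<times> carrier B,
     interp = (\<lambda>f zs. (interp A f (map fst zs), interp B f (map snd zs)))\<rparr>"

definition terminal_alg :: "(unit, 'f) algebra" where
  "terminal_alg = \<lparr>carrier = {()}, interp = (\<lambda>f zs. ())\<rparr>"


section \<open>Varieties of \<open>\<Omega>\<close>-groups\<close>

text \<open>The operation symbols are those of groups together with arbitrary further ones.\<close>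

datatype 'o gsym = Mul | Inv | Unit | Ext 'o

primrec arity :: "('o \<Rightarrow> nat) \<Rightarrow> 'o gsym \<Rightarrow> nat" where
  "arity ar Mul = 2"
| "arity ar Inv = 1"
| "arity ar Unit = 0"
| "arity ar (Ext \<omega>) = ar \<omega>"

abbreviation gmul :: "('a, 'o gsym) algebra \<Rightarrow> 'a \<Rightarrow> 'a \<Rightarrow> 'a" where
  "gmul A x y \<equiv> interp A Mul [x, y]"

abbreviation ginv :: "('a, 'o gsym) algebra \<Rightarrow> 'a \<Rightarrow> 'a" where
  "ginv A x \<equiv> interp A Inv [x]"

abbreviation gunit :: "('a, 'o gsym) algebra \<Rightarrow> 'a" where
  "gunit A \<equiv> interp A Unit []"

abbreviation (input) tmul :: "'o gsym trm \<Rightarrow> 'o gsym trm \<Rightarrow> 'o gsym trm" where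
  "tmul s t \<equiv> App Mul [s, t]"

abbreviation (input) tinv :: "'o gsym trm \<Rightarrow> 'o gsym trm" where
  "tinv t \<equiv> App Inv [t]"

abbreviation (input) tunit :: "'o gsym trm" where
  "tunit \<equiv> App Unit []"

definition group_identities :: "('o gsym trm \<times> 'o gsym trm) set" where
  "group_identities =
    {(tmul (tmul (Var 0) (Var 1)) (Var 2), tmul (Var 0) (tmul (Var 1) (Var 2))),
     (tmul tunit (Var 0), Var 0), (tmul (Var 0) tunit, Var 0),
     (tmul (tinv (Var 0)) (Var 0), tunit), (tmul (Var 0) (tinv (Var 0)), tunit)}"

text \<open>
  \<open>\<omega>(1,\<dots>,1) = 1\<close> for every operation \<open>\<omega>\<close>. For nullary \<open>\<omega>\<close> this says that the
  constant \<open>\<omega>\<close> is the unit, so that there is at most one constant.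
\<close>

definition unit_identities :: "('o \<Rightarrow> nat) \<Rightarrow> ('o gsym trm \<times> 'o gsym trm) set" where
  "unit_identities ar = {(App f (replicate (arity ar f) tunit), tunit) | f. True}"

text \<open>\<open>E\<close> is a set of identities whose models form a variety of \<open>\<Omega>\<close>-groups.\<close>

definition Omega_group_variety ::
    "('o \<Rightarrow> nat) \<Rightarrow> ('o gsym trm \<times> 'o gsym trm) set \<Rightarrow> bool" where
  "Omega_group_variety ar E \<longleftrightarrow>
     (\<forall>(s, t) \<in> E. wf_trm (arity ar) s \<and> wf_trm (arity ar) t) \<and>
     group_identities \<subseteq> E \<and> unit_identities ar \<subseteq> E"

definition ker_hom :: "('a, 'o gsym) algebra \<Rightarrow> ('b, 'o gsym) algebra \<Rightarrow> ('a \<Rightarrow> 'b) \<Rightarrow> 'a set" where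
  "ker_hom A B h = {x \<in> carrier A. h x = gunit B}"

text \<open>
  The codomain ranges over the algebras of the variety whose elements are sets of elements
  of \<open>A\<close>, which include all quotients of \<open>A\<close>. By \<open>ideal_ker_hom\<close> below, kernels of homomorphisms
  into algebras over any other type are ideals as well.
\<close>

definition Omega_ideal ::
    "('o \<Rightarrow> nat) \<Rightarrow> ('o gsym trm \<times> 'o gsym trm) set \<Rightarrow> ('a, 'o gsym) algebra \<Rightarrow> 'a set \<Rightarrow> bool" where
  "Omega_ideal ar E A I \<longleftrightarrow> subalgebra (arity ar) A I \<and>
     (\<exists>(B :: ('a set, 'o gsym) algebra) h.
        B \<in> Mod (arity ar) E \<and> h \<in> alg_hom (arity ar) A B \<and> I = ker_hom A B h)"

definition ideal_gen ::
    "('o \<Rightarrow> nat) \<Rightarrow> ('o gsym trm \<times> 'o gsym trm) set \<Rightarrow> ('a, 'o gsym) algebra \<Rightarrow> 'a set \<Rightarrow> 'a set" where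
  "ideal_gen ar E A S = \<Inter>{I. Omega_ideal ar E A I \<and> S \<subseteq> I}"

definition join_alg :: "('o \<Rightarrow> nat) \<Rightarrow> ('a, 'o gsym) algebra \<Rightarrow> 'a set \<Rightarrow> 'a set \<Rightarrow> ('a, 'o gsym) algebra" where
  "join_alg ar A M N = restrict_alg A (subalg_gen (arity ar) A (M \<union> N))"


section \<open>Commutators\<close>

text \<open>
  A tuple is given by an assignment \<open>nat \<Rightarrow> 'a\<close>, of which a term only uses the finitely many
  entries belonging to its variables; a finite tuple is extended by \<open>1\<close>. Terms are syntactic rather than taken modulo \<open>E\<close>; they
  are only ever evaluated in models of \<open>E\<close>.

  The element \<open>v(m n) v(n)\<^sup>-\<^sup>1 v(m)\<^sup>-\<^sup>1\<close>:
\<close>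

definition comm_word ::
    "('a, 'o gsym) algebra \<Rightarrow> 'o gsym trm \<Rightarrow> (nat \<Rightarrow> 'a) \<Rightarrow> (nat \<Rightarrow> 'a) \<Rightarrow> 'a" where
  "comm_word A v m n =
     gmul A (gmul A (eval_trm A (\<lambda>i. gmul A (m i) (n i)) v) (ginv A (eval_trm A n v))) (ginv A (eval_trm A m v))"

text \<open>
  The set of terms \<open>W\<close> of a subvariety \<open>\<B>\<close>. HOL cannot quantify over algebras of all types, so
  \<open>\<B>\<close> is represented by its members whose elements are terms. Up to isomorphism these are all
  countably generated members, hence they decide every term: see \<open>W_terms_universal\<close>.
\<close>

definition W_terms ::
    "('o \<Rightarrow> nat) \<Rightarrow> ('o gsym trm, 'o gsym) algebra set \<Rightarrow> 'o gsym trm set" where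
  "W_terms ar \<B> = {v. wf_trm (arity ar) v \<and>
     (\<forall>B \<in> \<B>. \<forall>b. range b \<subseteq> carrier B \<longrightarrow> eval_trm B b v = gunit B)}"

definition relative_commutator ::
    "('o \<Rightarrow> nat) \<Rightarrow> ('o gsym trm \<times> 'o gsym trm) set \<Rightarrow> ('o gsym trm, 'o gsym) algebra set \<Rightarrow>
     ('a, 'o gsym) algebra \<Rightarrow> 'a set \<Rightarrow> 'a set \<Rightarrow> 'a set" where
  "relative_commutator ar E \<B> A M N = ideal_gen ar E (join_alg ar A M N)
     ({comm_word A v m n | v m n. v \<in> W_terms ar \<B> \<and> range m \<subseteq> M \<and> range n \<subseteq> N} \<union>
      {eval_trm A p v | v p. v \<in> W_terms ar \<B> \<and> range p \<subseteq> M \<inter> N})"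

definition Higgins_commutator ::
    "('o \<Rightarrow> nat) \<Rightarrow> ('o gsym trm \<times> 'o gsym trm) set \<Rightarrow>
     ('a, 'o gsym) algebra \<Rightarrow> 'a set \<Rightarrow> 'a set \<Rightarrow> 'a set" where
  "Higgins_commutator ar E A M N = ideal_gen ar E (join_alg ar A M N)
     {comm_word A f m n | f m n. wf_trm (arity ar) f \<and> range m \<subseteq> M \<and> range n \<subseteq> N}"


section \<open>Abelian algebras\<close>

text \<open>
  An internal group: the multiplication \<open>A \<times> A \<rightarrow> A\<close>, unit \<open>1 \<rightarrow> A\<close> and inversion \<open>A \<rightarrow> A\<close> are
  homomorphisms. They are not required to be the group operations of the \<open>\<Omega>\<close>-group \<open>A\<close>.
\<close>

definition abelian :: "('o \<Rightarrow> nat) \<Rightarrow> ('a, 'o gsym) algebra \<Rightarrow> bool" where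
  "abelian ar A \<longleftrightarrow> (\<exists>\<mu> e \<iota>.
     \<mu> \<in> alg_hom (arity ar) (prod_alg A A) A \<and>
     e \<in> alg_hom (arity ar) terminal_alg A \<and>
     \<iota> \<in> alg_hom (arity ar) A A \<and>
     (let G = \<lparr>carrier = carrier A, monoid.mult = (\<lambda>x y. \<mu> (x, y)), one = e ()\<rparr>
      in group G \<and> (\<forall>x \<in> carrier A. \<iota> x = inv\<^bsub>G\<^esub> x)))"

definition Ab :: "('o \<Rightarrow> nat) \<Rightarrow> ('o gsym trm \<times> 'o gsym trm) set \<Rightarrow> ('a, 'o gsym) algebra set" where
  "Ab ar E = {A \<in> Mod (arity ar) E. abelian ar A}"


section \<open>Independence of the types over which algebras range\<close>

lemma eval_closed:
  assumes "closed_under ar A S" "range \<rho> \<subseteq> S" "wf_trm ar t"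
  shows "eval_trm A \<rho> t \<in> S"
  using assms(3)
proof (induction t)
  case (Var i)
  then show ?case using assms(2) by auto
next
  case (App f ts)
  then have "set (map (eval_trm A \<rho>) ts) \<subseteq> S" "length (map (eval_trm A \<rho>) ts) = ar f"
    by auto
  then show ?case using assms(1) unfolding closed_under_def eval_trm.simps by blast
qed

lemma eval_hom:
  assumes "closed_under ar A (carrier A)" "h \<in> alg_hom ar A B" "range \<rho> \<subseteq> carrier A" "wf_trm ar t"
  shows "h (eval_trm A \<rho> t) = eval_trm B (\<lambda>i. h (\<rho> i)) t"
  using assms(4)
proof (induction t)
  case (Var i)
  then show ?case by simp
next
  case (App f ts)
  then have "set (map (eval_trm A \<rho>) ts) \<subseteq> carrier A" "length (map (eval_trm A \<rho>) ts) = ar f"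
    using eval_closed[OF assms(1,3)] by auto
  then have "h (eval_trm A \<rho> (App f ts)) = interp B f (map h (map (eval_trm A \<rho>) ts))"
    using assms(2) unfolding alg_hom_def eval_trm.simps by blast
  also have "map h (map (eval_trm A \<rho>) ts) = map (eval_trm B (\<lambda>i. h (\<rho> i))) ts"
    using App by auto
  finally show ?case by (simp only: eval_trm.simps)
qed

lemma Mod_inj_hom:
  assumes "closed_under ar A (carrier A)" "h \<in> alg_hom ar A B" "inj_on h (carrier A)"
    and "B \<in> Mod ar E" "\<forall>(s, t) \<in> E. wf_trm ar s \<and> wf_trm ar t"
  shows "A \<in> Mod ar E"
proof -
  have "eval_trm A \<rho> s = eval_trm A \<rho> t" if "(s, t) \<in> E" "range \<rho> \<subseteq> carrier A" for s t \<rho>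
  proof -
    have wf: "wf_trm ar s" "wf_trm ar t" using assms(5) that by auto
    have "range (\<lambda>i. h (\<rho> i)) \<subseteq> carrier B"
      using that(2) assms(2) by (auto simp: alg_hom_def)
    then have "eval_trm B (\<lambda>i. h (\<rho> i)) s = eval_trm B (\<lambda>i. h (\<rho> i)) t"
      using assms(4) that(1) unfolding Mod_def by blast
    then have "h (eval_trm A \<rho> s) = h (eval_trm A \<rho> t)"
      using eval_hom[OF assms(1,2) that(2)] wf by simp
    then show ?thesis
      using assms(3) eval_closed[OF assms(1) that(2)] wf by (auto dest: inj_onD)
  qed
  then show ?thesis using assms(1) unfolding Mod_def by blast
qed

lemma Mod_Un: "Mod ar (E \<union> E') = Mod ar E \<inter> Mod ar E'"
  by (auto simp: Mod_def)

lemma Mod_identity: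
  assumes "A \<in> Mod ar E" "(s, t) \<in> E" "range \<rho> \<subseteq> carrier A"
  shows "eval_trm A \<rho> s = eval_trm A \<rho> t"
  using assms unfolding Mod_def by blast

lemma unit_law:
  assumes "Omega_group_variety ar E" "A \<in> Mod (arity ar) E"
  shows "gunit A \<in> carrier A" "interp A f (replicate (arity ar f) (gunit A)) = gunit A"
proof -
  show u: "gunit A \<in> carrier A"
    using assms(2) by (auto simp: Mod_def closed_under_def)
  have "(App f (replicate (arity ar f) tunit), tunit) \<in> E"
    using assms(1) by (auto simp: Omega_group_variety_def unit_identities_def)
  from Mod_identity[OF assms(2) this, of "\<lambda>_. gunit A"]
  show "interp A f (replicate (arity ar f) (gunit A)) = gunit A" using u by simp
qed

lemma group_laws:
  assumes E: "Omega_group_variety ar E" and A: "A \<in> Mod (arity ar) E"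
  shows "\<And>x y. \<lbrakk>x \<in> carrier A; y \<in> carrier A\<rbrakk> \<Longrightarrow> gmul A x y \<in> carrier A"
    and "\<And>x. x \<in> carrier A \<Longrightarrow> ginv A x \<in> carrier A"
    and "\<And>x y z. \<lbrakk>x \<in> carrier A; y \<in> carrier A; z \<in> carrier A\<rbrakk> \<Longrightarrow>
           gmul A (gmul A x y) z = gmul A x (gmul A y z)"
    and "\<And>x. x \<in> carrier A \<Longrightarrow> gmul A (gunit A) x = x"
    and "\<And>x. x \<in> carrier A \<Longrightarrow> gmul A x (gunit A) = x"
    and "\<And>x. x \<in> carrier A \<Longrightarrow> gmul A (ginv A x) x = gunit A"
    and "\<And>x. x \<in> carrier A \<Longrightarrow> gmul A x (ginv A x) = gunit A"
proof -
  have sub: "group_identities \<subseteq> E" using E by (simp add: Omega_group_variety_def)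
  show "gmul A x y \<in> carrier A" if "x \<in> carrier A" "y \<in> carrier A" for x y
    using A that by (auto simp: Mod_def closed_under_def)
  show "ginv A x \<in> carrier A" if "x \<in> carrier A" for x
    using A that by (auto simp: Mod_def closed_under_def)
  show "gmul A (gmul A x y) z = gmul A x (gmul A y z)"
    if "x \<in> carrier A" "y \<in> carrier A" "z \<in> carrier A" for x y z
  proof -
    have "(tmul (tmul (Var 0) (Var 1)) (Var 2), tmul (Var 0) (tmul (Var 1) (Var 2))) \<in> E"
      using sub by (auto simp: group_identities_def)
    from Mod_identity[OF A this, of "\<lambda>i. if i = 0 then x else if i = 1 then y else z"]
    show ?thesis using that by auto
  qed
  fix x assume x: "x \<in> carrier A"
  have *: "eval_trm A (\<lambda>_. x) s = eval_trm A (\<lambda>_. x) t" if "(s, t) \<in> group_identities" for s t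
    using Mod_identity[OF A, of s t] that sub x by auto
  show "gmul A (gunit A) x = x" using *[of "tmul tunit (Var 0)" "Var 0"]
    by (simp add: group_identities_def)
  show "gmul A x (gunit A) = x" using *[of "tmul (Var 0) tunit" "Var 0"]
    by (simp add: group_identities_def)
  show "gmul A (ginv A x) x = gunit A" using *[of "tmul (tinv (Var 0)) (Var 0)" tunit]
    by (simp add: group_identities_def)
  show "gmul A x (ginv A x) = gunit A" using *[of "tmul (Var 0) (tinv (Var 0))" tunit]
    by (simp add: group_identities_def)
qed

lemma ideal_ker_hom:
  fixes A :: "('a, 'o gsym) algebra" and B :: "('b, 'o gsym) algebra"
  assumes E: "Omega_group_variety ar E" and A: "A \<in> Mod (arity ar) E" and B: "B \<in> Mod (arity ar) E"
    and h: "h \<in> alg_hom (arity ar) A B"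
  shows "Omega_ideal ar E A (ker_hom A B h)"
proof -
  let ?ar = "arity ar"
  have clA: "closed_under ?ar A (carrier A)" using A by (simp add: Mod_def)
  have h_car: "h x \<in> carrier B" if "x \<in> carrier A" for x
    using h that by (auto simp: alg_hom_def)
  have h_op: "h (interp A f xs) = interp B f (map h xs)"
    if "length xs = ?ar f" "set xs \<subseteq> carrier A" for f xs
    using h that by (auto simp: alg_hom_def)
  have cl: "interp A f xs \<in> carrier A" if "length xs = ?ar f" "set xs \<subseteq> carrier A" for f xs
    using clA that by (auto simp: closed_under_def)
  have "subalgebra ?ar A (ker_hom A B h)"
    unfolding subalgebra_def closed_under_def
  proof (intro conjI allI impI)
    show "ker_hom A B h \<subseteq> carrier A" by (auto simp: ker_hom_def)
    fix f xs assume len: "length xs = ?ar f" and xs: "set xs \<subseteq> ker_hom A B h"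
    have xsA: "set xs \<subseteq> carrier A" using xs by (auto simp: ker_hom_def)
    have "map h xs = replicate (?ar f) (gunit B)"
      by (rule replicate_eqI) (use xs len in \<open>auto simp: ker_hom_def\<close>)
    then have "h (interp A f xs) = gunit B"
      using h_op[OF len xsA] unit_law(2)[OF E B] by simp
    then show "interp A f xs \<in> ker_hom A B h" using cl[OF len xsA] by (simp add: ker_hom_def)
  qed
  moreover have "\<exists>(C :: ('a set, 'o gsym) algebra) g.
      C \<in> Mod ?ar E \<and> g \<in> alg_hom ?ar A C \<and> ker_hom A B h = ker_hom A C g"
  proof -
    define F where "F y = {x \<in> carrier A. h x = y}" for y
    define g where "g x = F (h x)" for x
    define k where "k X = h (SOME x. x \<in> X)" for X :: "'a set"
    define C :: "('a set, 'o gsym) algebra" where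
      "C = \<lparr>carrier = g ` carrier A, interp = (\<lambda>f Xs. F (interp B f (map k Xs)))\<rparr>"
    have kg: "k (g x) = h x" if "x \<in> carrier A" for x
    proof -
      have "x \<in> g x" using that by (simp add: g_def F_def)
      then have "(SOME z. z \<in> g x) \<in> g x" by (rule someI)
      then show ?thesis by (simp add: k_def g_def F_def)
    qed
    have C_op: "interp C f (map g xs) = g (interp A f xs)"
      if "length xs = ?ar f" "set xs \<subseteq> carrier A" for f xs
    proof -
      have "map k (map g xs) = map h xs" using kg that(2) by auto
      then have "interp C f (map g xs) = F (interp B f (map h xs))"
        by (simp only: C_def algebra.simps)
      then show ?thesis using h_op[OF that] by (simp add: g_def)
    qed
    have lift: "\<exists>xs. Xs = map g xs \<and> set xs \<subseteq> carrier A" if "set Xs \<subseteq> carrier C" for Xs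
      using that
    proof (induction Xs)
      case (Cons X Xs)
      then obtain xs x where "Xs = map g xs" "set xs \<subseteq> carrier A" "x \<in> carrier A" "X = g x"
        by (auto simp: C_def)
      then show ?case by (intro exI[of _ "x # xs"]) auto
    qed auto
    have clC: "closed_under ?ar C (carrier C)"
      unfolding closed_under_def
    proof (intro allI impI)
      fix f Xs assume len: "length Xs = ?ar f" and Xs: "set Xs \<subseteq> carrier C"
      then obtain xs where xs: "Xs = map g xs" "set xs \<subseteq> carrier A" using lift by blast
      then have "interp C f Xs = g (interp A f xs)" using C_op len by simp
      then show "interp C f Xs \<in> carrier C" using cl xs len by (simp add: C_def)
    qed
    have kh: "k \<in> alg_hom ?ar C B"
      unfolding alg_hom_def
    proof (intro CollectI conjI allI impI)
      show "k \<in> carrier C \<rightarrow> carrier B" using kg h_car by (auto simp: C_def)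
      fix f Xs assume len: "length Xs = ?ar f" and Xs: "set Xs \<subseteq> carrier C"
      then obtain xs where xs: "Xs = map g xs" "set xs \<subseteq> carrier A" using lift by blast
      have "k (interp C f Xs) = h (interp A f xs)" using C_op kg cl xs len by simp
      also have "\<dots> = interp B f (map h xs)" using h_op xs len by simp
      also have "map h xs = map k Xs" using xs kg by auto
      finally show "k (interp C f Xs) = interp B f (map k Xs)" .
    qed
    have inj: "inj_on k (carrier C)"
    proof (rule inj_onI)
      fix X Y assume "X \<in> carrier C" "Y \<in> carrier C" and eq: "k X = k Y"
      then obtain x y where "x \<in> carrier A" "X = g x" "y \<in> carrier A" "Y = g y"
        by (auto simp: C_def)
      with eq kg show "X = Y" by (simp add: g_def)
    qed
    have "C \<in> Mod ?ar E"
      using Mod_inj_hom[OF clC kh inj B] E by (simp add: Omega_group_variety_def)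
    moreover have "g \<in> alg_hom ?ar A C"
      unfolding alg_hom_def using C_op by (auto simp: C_def)
    moreover have "ker_hom A B h = ker_hom A C g"
    proof -
      have "gunit C = g (gunit A)" using C_op[of "[]" Unit] by simp
      moreover have "h (gunit A) = gunit B" using h_op[of "[]" Unit] by simp
      moreover have "g x = g y \<longleftrightarrow> h x = h y" if "x \<in> carrier A" "y \<in> carrier A" for x y
        using that kg by (metis g_def)
      ultimately show ?thesis
        unfolding ker_hom_def using unit_law(1)[OF E A] by (intro Collect_cong conj_cong refl) simp
    qed
    ultimately show ?thesis by blast
  qed
  ultimately show ?thesis unfolding Omega_ideal_def by blast
qed

lemma W_terms_universal:
  fixes C :: "('c, 'o gsym) algebra"
  assumes E: "\<forall>(s, t) \<in> E. wf_trm (arity ar) s \<and> wf_trm (arity ar) t"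
    and v: "v \<in> W_terms ar (Mod (arity ar) E)"
    and C: "C \<in> Mod (arity ar) E" and \<rho>: "range \<rho> \<subseteq> carrier C"
  shows "eval_trm C \<rho> v = gunit C"
proof -
  let ?ar = "arity ar"
  define T where "T = {t. wf_trm ?ar t}"
  define h where "h = eval_trm C \<rho>"
  define r where "r = inv_into T h"
  define B :: "('o gsym trm, 'o gsym) algebra" where
    "B = \<lparr>carrier = r ` h ` T, interp = (\<lambda>f ts. r (interp C f (map h ts)))\<rparr>"
  have clC: "closed_under ?ar C (carrier C)" using C by (simp add: Mod_def)
  have rT: "r y \<in> T" "h (r y) = y" if "y \<in> h ` T" for y
    using that by (simp_all add: r_def inv_into_into f_inv_into_f)
  have BT: "carrier B \<subseteq> T" using rT by (auto simp: B_def)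
  have op: "interp C f (map h ts) \<in> h ` T" if "length ts = ?ar f" "set ts \<subseteq> carrier B" for f ts
  proof -
    have "App f ts \<in> T" using that BT by (auto simp: T_def)
    moreover have "h (App f ts) = interp C f (map h ts)" by (simp add: h_def)
    ultimately show ?thesis by (metis imageI)
  qed
  have clB: "closed_under ?ar B (carrier B)"
    unfolding closed_under_def using op by (auto simp: B_def)
  have hom: "h \<in> alg_hom ?ar B C"
    unfolding alg_hom_def
  proof (intro CollectI conjI allI impI)
    show "h \<in> carrier B \<rightarrow> carrier C"
      using BT eval_closed[OF clC \<rho>] by (auto simp: h_def T_def)
    show "h (interp B f ts) = interp C f (map h ts)"
      if "length ts = ?ar f" "set ts \<subseteq> carrier B" for f ts
      using rT(2)[OF op[OF that]] by (simp add: B_def)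
  qed
  have inj: "inj_on h (carrier B)"
    by (rule inj_onI) (auto simp: B_def rT(2))
  have B: "B \<in> Mod ?ar E" using Mod_inj_hom[OF clB hom inj C E] .
  define b where "b i = r (\<rho> i)" for i
  have \<rho>T: "\<rho> i \<in> h ` T" for i
    by (rule image_eqI[of _ _ "Var i"]) (auto simp: h_def T_def)
  have b: "range b \<subseteq> carrier B" using \<rho>T by (auto simp: b_def B_def)
  have hb: "(\<lambda>i. h (b i)) = \<rho>" using rT(2)[OF \<rho>T] by (auto simp: b_def)
  have wf: "wf_trm ?ar v" using v by (simp add: W_terms_def)
  have "eval_trm B b v = gunit B" using v B b by (simp add: W_terms_def)
  then have "h (eval_trm B b v) = gunit C" using hom by (simp add: alg_hom_def)
  then show ?thesis using eval_hom[OF clB hom b wf] hb by simp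
qed

text \<open>The abelian algebras form a subvariety, given by the following additional identities.\<close>

definition abelian_identities :: "('o \<Rightarrow> nat) \<Rightarrow> ('o gsym trm \<times> 'o gsym trm) set" where
  "abelian_identities ar =
    {(App f (map (\<lambda>i. tmul (Var (2 * i)) (Var (2 * i + 1))) [0..<arity ar f]),
      tmul (App f (map (\<lambda>i. Var (2 * i)) [0..<arity ar f]))
           (App f (map (\<lambda>i. Var (2 * i + 1)) [0..<arity ar f]))) | f. True}"

lemma Ab_eq_Mod:
  fixes ar :: "'o \<Rightarrow> nat"
  assumes E: "Omega_group_variety ar E"
  shows "(Ab ar E :: ('a, 'o gsym) algebra set) = Mod (arity ar) (E \<union> abelian_identities ar)"
proof (intro equalityI subsetI)
  let ?ar = "arity ar"
  fix A :: "('a, 'o gsym) algebra"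
  assume "A \<in> Ab ar E"
  then have A: "A \<in> Mod ?ar E" and ab: "abelian ar A" by (auto simp: Ab_def)
  note gl = group_laws[OF E A]
  note u = unit_law[OF E A]
  obtain \<mu> e \<iota> where mu: "\<mu> \<in> alg_hom ?ar (prod_alg A A) A"
    and e: "e \<in> alg_hom ?ar terminal_alg A"
    and G: "group \<lparr>carrier = carrier A, monoid.mult = (\<lambda>x y. \<mu> (x, y)), one = e ()\<rparr>"
    using ab unfolding abelian_def Let_def by blast
  have mu_op: "\<mu> (interp A f (map fst zs), interp A f (map snd zs)) = interp A f (map \<mu> zs)"
    if "length zs = ?ar f" "set zs \<subseteq> carrier A \<times> carrier A" for f zs
    using mu that by (auto simp: alg_hom_def prod_alg_def)
  have e1: "e () = gunit A"
    using e by (auto simp: alg_hom_def terminal_alg_def dest: spec[of _ Unit])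
  have mu1: "\<mu> (x, gunit A) = x" "\<mu> (gunit A, x) = x" if "x \<in> carrier A" for x
    using monoid.r_one[OF group.is_monoid[OF G]] monoid.l_one[OF group.is_monoid[OF G]] that e1
    by auto
  have mu_mul: "\<mu> (x, y) = gmul A x y" if "x \<in> carrier A" "y \<in> carrier A" for x y
    using mu_op[of "[(x, gunit A), (gunit A, y)]" Mul] that u(1) gl mu1 by simp
  have "eval_trm A \<rho> s = eval_trm A \<rho> t" if st: "(s, t) \<in> abelian_identities ar" and r: "range \<rho> \<subseteq> carrier A"
    for s t \<rho>
  proof -
    obtain f where s: "s = App f (map (\<lambda>i. tmul (Var (2 * i)) (Var (2 * i + 1))) [0..<?ar f])"
      and t: "t = tmul (App f (map (\<lambda>i. Var (2 * i)) [0..<?ar f]))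
           (App f (map (\<lambda>i. Var (2 * i + 1)) [0..<?ar f]))"
      using st by (auto simp: abelian_identities_def)
    let ?zs = "map (\<lambda>i. (\<rho> (2 * i), \<rho> (2 * i + 1))) [0..<?ar f]"
    have rc: "\<rho> i \<in> carrier A" for i using r by auto
    have cl: "interp A f (map g [0..<?ar f]) \<in> carrier A" if "\<And>i. g i \<in> carrier A" for g
    proof -
      have "set (map g [0..<?ar f]) \<subseteq> carrier A" "length (map g [0..<?ar f]) = ?ar f"
        using that by auto
      then show ?thesis using A unfolding Mod_def closed_under_def by blast
    qed
    have "interp A f (map \<mu> ?zs) = \<mu> (interp A f (map fst ?zs), interp A f (map snd ?zs))"
      by (rule mu_op[of ?zs f, symmetric]) (use rc in auto)
    then show ?thesis
      using rc cl by (simp add: s t comp_def mu_mul)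
  qed
  then have "A \<in> Mod ?ar (abelian_identities ar)" using A by (auto simp: Mod_def)
  then show "A \<in> Mod ?ar (E \<union> abelian_identities ar)" using A by (simp add: Mod_Un)
next
  let ?ar = "arity ar"
  fix A :: "('a, 'o gsym) algebra"
  assume A': "A \<in> Mod ?ar (E \<union> abelian_identities ar)"
  then have A: "A \<in> Mod ?ar E" by (auto simp: Mod_Un)
  note gl = group_laws[OF E A]
  note u = unit_law[OF E A]
  have cl: "interp A f xs \<in> carrier A" if "length xs = ?ar f" "set xs \<subseteq> carrier A" for f xs
    using A that by (auto simp: Mod_def closed_under_def)
  have mul_op: "interp A f (map (\<lambda>z. gmul A (fst z) (snd z)) zs) =
      gmul A (interp A f (map fst zs)) (interp A f (map snd zs))"
    if len: "length zs = ?ar f" and zs: "set zs \<subseteq> carrier A \<times> carrier A" for f zs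
  proof -
    define \<rho> where "\<rho> i = (if i div 2 < length zs
      then if even i then fst (zs ! (i div 2)) else snd (zs ! (i div 2)) else gunit A)" for i
    have nz: "zs ! i \<in> carrier A \<times> carrier A" if "i < length zs" for i
      using zs that nth_mem by blast
    have r: "range \<rho> \<subseteq> carrier A" using nz u(1) by (auto simp: \<rho>_def mem_Times_iff)
    have "(App f (map (\<lambda>i. tmul (Var (2 * i)) (Var (2 * i + 1))) [0..<?ar f]),
        tmul (App f (map (\<lambda>i. Var (2 * i)) [0..<?ar f]))
           (App f (map (\<lambda>i. Var (2 * i + 1)) [0..<?ar f]))) \<in> E \<union> abelian_identities ar"
      by (auto simp: abelian_identities_def)
    from Mod_identity[OF A' this r]
    have "interp A f (map (\<lambda>i. gmul A (\<rho> (2 * i)) (\<rho> (2 * i + 1))) [0..<length zs]) =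
        gmul A (interp A f (map (\<lambda>i. \<rho> (2 * i)) [0..<length zs]))
          (interp A f (map (\<lambda>i. \<rho> (2 * i + 1)) [0..<length zs]))"
      by (simp add: comp_def len)
    moreover have "map (\<lambda>i. gmul A (\<rho> (2 * i)) (\<rho> (2 * i + 1))) [0..<length zs] =
        map (\<lambda>z. gmul A (fst z) (snd z)) zs"
      by (rule nth_equalityI) (auto simp: \<rho>_def)
    moreover have "map (\<lambda>i. \<rho> (2 * i)) [0..<length zs] = map fst zs"
      by (rule nth_equalityI) (auto simp: \<rho>_def)
    moreover have "map (\<lambda>i. \<rho> (2 * i + 1)) [0..<length zs] = map snd zs"
      by (rule nth_equalityI) (auto simp: \<rho>_def)
    ultimately show ?thesis by simp
  qed
  let ?G = "\<lparr>carrier = carrier A, monoid.mult = (\<lambda>x y. gmul A x y), one = gunit A\<rparr>"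
  have G: "group ?G"
  proof (rule groupI)
    show "\<exists>y \<in> carrier ?G. y \<otimes>\<^bsub>?G\<^esub> x = \<one>\<^bsub>?G\<^esub>" if "x \<in> carrier ?G" for x
      using gl(2,6)[of x] that by auto
  qed (use gl u(1) in auto)
  have inv: "inv\<^bsub>?G\<^esub> x = ginv A x" if "x \<in> carrier A" for x
    using group.inv_equality[OF G, of "ginv A x" x] gl that by simp
  have mu: "(\<lambda>z. gmul A (fst z) (snd z)) \<in> alg_hom ?ar (prod_alg A A) A"
    using mul_op gl by (auto simp: alg_hom_def prod_alg_def)
  have map_unit: "map (\<lambda>_. gunit A) xs = replicate (length xs) (gunit A)" for xs :: "'z list"
    by (simp add: map_replicate_const)
  have ee: "(\<lambda>_. gunit A) \<in> alg_hom ?ar terminal_alg A"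
    using u by (auto simp: alg_hom_def terminal_alg_def map_unit)
  have "ginv A (interp A f xs) = interp A f (map (ginv A) xs)"
    if "length xs = ?ar f" "set xs \<subseteq> carrier A" for f xs
  proof -
    let ?zs = "map (\<lambda>x. (ginv A x, x)) xs"
    have "map (\<lambda>z. gmul A (fst z) (snd z)) ?zs = replicate (?ar f) (gunit A)"
    proof (rule replicate_eqI)
      fix y assume "y \<in> set (map (\<lambda>z. gmul A (fst z) (snd z)) ?zs)"
      then obtain x where "x \<in> set xs" "y = gmul A (ginv A x) x" by auto
      with that(2) gl(6)[of x] show "y = gunit A" by blast
    qed (use that in simp)
    moreover have "set ?zs \<subseteq> carrier A \<times> carrier A"
      using that(2) gl(2) by auto
    ultimately have "gmul A (interp A f (map (ginv A) xs)) (interp A f xs) = gunit A"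
      using mul_op[of ?zs f] that(1) u(2)[of f] by (simp add: comp_def)
    moreover have "set (map (ginv A) xs) \<subseteq> carrier A" using that(2) gl(2) by auto
    then have "interp A f xs \<in> carrier A" "interp A f (map (ginv A) xs) \<in> carrier A"
      using cl[of xs f] cl[of "map (ginv A) xs" f] that by simp_all
    ultimately show ?thesis
      using group.inv_equality[OF G, of "interp A f (map (ginv A) xs)" "interp A f xs"] inv by simp
  qed
  then have io: "ginv A \<in> alg_hom ?ar A A" using gl(2) by (auto simp: alg_hom_def)
  have "abelian ar A"
    unfolding abelian_def Let_def
    by (intro exI[of _ "\<lambda>z. gmul A (fst z) (snd z)"] exI[of _ "\<lambda>_. gunit A"] exI[of _ "\<lambda>x. ginv A x"])
      (use mu ee io G inv in auto)
  then show "A \<in> Ab ar E" using A by (simp add: Ab_def)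
qed

end

(* One inclusion holds already for the generators: v(x,y) = f(xy) f(y)^-1 f(x)^-1 vanishes on
   abelian algebras and on the tuples (m,1) and (1,n), so the generator
   v((m,1)(1,n)) v(1,n)^-1 v(m,1)^-1 of the relative commutator is f(mn) f(n)^-1 f(m)^-1.
   Conversely, modulo Higgins's commutator every operation is multiplicative on the image of
   the intersection of M and N, which is therefore abelian, so every term of W vanishes there. *)
theory Submission
  imports Defs
begin

section \<open>Substitution in terms\<close>

primrec subst_trm :: "(nat \<Rightarrow> 'f trm) \<Rightarrow> 'f trm \<Rightarrow> 'f trm" where
  "subst_trm \<sigma> (Var i) = \<sigma> i"
| "subst_trm \<sigma> (App f ts) = App f (map (subst_trm \<sigma>) ts)"

text \<open>Renaming variables by substitution will allow a commutator word, which involves two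
  tuples, to be read as the value of a single term at one tuple.\<close>

lemma eval_subst_trm: "eval_trm A \<rho> (subst_trm \<sigma> t) = eval_trm A (\<lambda>i. eval_trm A \<rho> (\<sigma> i)) t"
  by (induction t) (auto cong: map_cong simp: comp_def)

lemma wf_subst_trm:
  "\<lbrakk>wf_trm ar t; \<And>i. wf_trm ar (\<sigma> i)\<rbrakk> \<Longrightarrow> wf_trm ar (subst_trm \<sigma> t)"
  by (induction t) auto

section \<open>Restriction to subalgebras, generated subalgebras and images\<close>

lemma eval_restrict_alg [simp]: "eval_trm (restrict_alg A S) \<rho> t = eval_trm A \<rho> t"
  by (induction t) (auto simp: restrict_alg_def cong: map_cong)

lemma interp_restrict_alg [simp]: "interp (restrict_alg A S) = interp A"
  by (simp add: restrict_alg_def)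

lemma carrier_restrict_alg [simp]: "carrier (restrict_alg A S) = S"
  by (simp add: restrict_alg_def)

lemma comm_word_restrict_alg [simp]: "comm_word (restrict_alg A S) v m n = comm_word A v m n"
  by (simp add: comm_word_def)

lemma Mod_restrict_alg:
  fixes A :: "('a, 'f) algebra"
  assumes "A \<in> Mod ar E" "subalgebra ar A S"
  shows "restrict_alg A S \<in> Mod ar E"
proof -
  have "closed_under ar (restrict_alg A S) S"
    using assms(2) by (simp add: subalgebra_def closed_under_def)
  moreover have "range \<rho> \<subseteq> carrier A" if "range \<rho> \<subseteq> S" for \<rho> :: "nat \<Rightarrow> 'a"
    using assms(2) that by (auto simp: subalgebra_def)
  ultimately show ?thesis using assms(1) by (auto simp: Mod_def)
qed

lemma subalgebra_subalg_gen:
  assumes "closed_under ar A (carrier A)" "S \<subseteq> carrier A"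
  shows "subalgebra ar A (subalg_gen ar A S)"
proof -
  \<comment> \<open>The intersection defining \<open>subalg_gen\<close> is over a nonempty family,
    so it stays inside the carrier.\<close>
  have "subalgebra ar A (carrier A)" using assms(1) by (simp add: subalgebra_def)
  then have "subalg_gen ar A S \<subseteq> carrier A" using assms(2) by (auto simp: subalg_gen_def)
  moreover have "closed_under ar A (subalg_gen ar A S)"
    unfolding closed_under_def subalg_gen_def
  proof (intro allI impI InterI)
    fix f xs T
    assume "length xs = ar f" and xs: "set xs \<subseteq> \<Inter> {T. subalgebra ar A T \<and> S \<subseteq> T}"
      and T: "T \<in> {T. subalgebra ar A T \<and> S \<subseteq> T}"
    moreover have "set xs \<subseteq> T" using xs T by (meson Inter_lower subset_trans)
    ultimately show "interp A f xs \<in> T" by (simp add: subalgebra_def closed_under_def)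
  qed
  ultimately show ?thesis by (simp add: subalgebra_def)
qed

lemma subalgebra_image:
  assumes h: "h \<in> alg_hom ar A B" and S: "subalgebra ar A S"
  shows "subalgebra ar B (h ` S)"
  unfolding subalgebra_def closed_under_def
proof (intro conjI allI impI)
  show "h ` S \<subseteq> carrier B" using h S by (auto simp: alg_hom_def subalgebra_def)
  fix f ys assume len: "length ys = ar f" and ys: "set ys \<subseteq> h ` S"
  \<comment> \<open>Passing through \<open>lists\<close> lifts the whole argument tuple to a tuple
    over \<open>S\<close> at once.\<close>
  from ys have "ys \<in> lists (h ` S)" by auto
  then obtain xs where xs: "ys = map h xs" "set xs \<subseteq> S" by (auto simp: lists_image)
  have "interp B f ys = h (interp A f xs)"
    using h S xs len unfolding alg_hom_def subalgebra_def by fastforce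
  moreover have "interp A f xs \<in> S"
    using S xs len by (simp add: subalgebra_def closed_under_def)
  ultimately show "interp B f ys \<in> h ` S" by simp
qed

section \<open>Commutator words in an Omega-group\<close>

lemma eval_unit:
  assumes "Omega_group_variety ar E" "A \<in> Mod (arity ar) E" "wf_trm (arity ar) t"
  shows "eval_trm A (\<lambda>_. gunit A) t = gunit A"
  using assms(3)
proof (induction t)
  case (App f ts)
  then have "map (eval_trm A (\<lambda>_. gunit A)) ts = replicate (arity ar f) (gunit A)"
    by (intro replicate_eqI) auto
  then show ?case using unit_law(2)[OF assms(1,2)] by simp
qed simp

lemma hom_comm_word:
  assumes E: "Omega_group_variety ar E" and A: "A \<in> Mod (arity ar) E"
    and h: "h \<in> alg_hom (arity ar) A B" and v: "wf_trm (arity ar) v"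
    and m: "range m \<subseteq> carrier A" and n: "range n \<subseteq> carrier A"
  shows "h (comm_word A v m n) = comm_word B v (\<lambda>i. h (m i)) (\<lambda>i. h (n i))"
proof -
  have cl: "closed_under (arity ar) A (carrier A)" using A by (simp add: Mod_def)
  note gl = group_laws[OF E A]
  have hop: "h (gmul A x y) = gmul B (h x) (h y)" "h (ginv A x) = ginv B (h x)"
    if "x \<in> carrier A" "y \<in> carrier A" for x y
    using h that by (simp_all add: alg_hom_def)
  have mn: "range (\<lambda>i. gmul A (m i) (n i)) \<subseteq> carrier A"
    using gl(1) m n by (simp add: image_subset_iff)
  have "h (m i) = h (m i) \<and> h (gmul A (m i) (n i)) = gmul B (h (m i)) (h (n i))" for i
    using hop(1) m n by (simp add: image_subset_iff)
  then show ?thesis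
    using eval_closed[OF cl mn v] eval_closed[OF cl m v] eval_closed[OF cl n v]
    by (simp add: comm_word_def hop gl(1,2) eval_hom[OF cl h _ v] m n mn)
qed

text \<open>With x, y, z the values of \<open>v\<close> at the product tuple, at \<open>m\<close>
  and at \<open>n\<close>, the word is x z^-1 y^-1, and z^-1 y^-1 is the inverse of y z. This
  converts between vanishing commutator words and multiplicativity of terms.\<close>

lemma comm_word_eq_unit_iff:
  assumes E: "Omega_group_variety ar E" and A: "A \<in> Mod (arity ar) E"
    and v: "wf_trm (arity ar) v" and m: "range m \<subseteq> carrier A" and n: "range n \<subseteq> carrier A"
  shows "comm_word A v m n = gunit A \<longleftrightarrow>
    eval_trm A (\<lambda>i. gmul A (m i) (n i)) v = gmul A (eval_trm A m v) (eval_trm A n v)"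
proof -
  have cl: "closed_under (arity ar) A (carrier A)" using A by (simp add: Mod_def)
  note gl = group_laws[OF E A]
  have "range (\<lambda>i. gmul A (m i) (n i)) \<subseteq> carrier A"
    using gl(1) m n by (simp add: image_subset_iff)
  note c = eval_closed[OF cl this v] eval_closed[OF cl m v] eval_closed[OF cl n v]
  have "gmul A (gmul A x (ginv A z)) (ginv A y) = gunit A \<longleftrightarrow> x = gmul A y z"
    if "x \<in> carrier A" "y \<in> carrier A" "z \<in> carrier A" for x y z
  proof
    assume "gmul A (gmul A x (ginv A z)) (ginv A y) = gunit A"
    then have "gmul A (gmul A (gmul A x (ginv A z)) (ginv A y)) (gmul A y z)
      = gmul A (gunit A) (gmul A y z)" by simp
    moreover have "gmul A (gmul A (gmul A x (ginv A z)) (ginv A y)) (gmul A y z)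
      = gmul A x (gmul A (ginv A z) (gmul A (gmul A (ginv A y) y) z))"
      using that by (simp add: gl(1-3))
    ultimately show "x = gmul A y z" using that by (simp add: gl)
  next
    assume "x = gmul A y z"
    moreover have "gmul A (gmul A (gmul A y z) (ginv A z)) (ginv A y)
      = gmul A (gmul A y (gmul A z (ginv A z))) (ginv A y)"
      using that by (simp add: gl(1-3))
    ultimately show "gmul A (gmul A x (ginv A z)) (ginv A y) = gunit A"
      using that by (simp add: gl)
  qed
  then show ?thesis using c by (simp add: comm_word_def)
qed

section \<open>Abelian algebras and the terms that vanish on them\<close>

lemma eval_mul_abelian:
  assumes E: "Omega_group_variety ar E"
    and A': "A \<in> Mod (arity ar) (E \<union> abelian_identities ar)"
    and m: "range m \<subseteq> carrier A" and n: "range n \<subseteq> carrier A" and t: "wf_trm (arity ar) t"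
  shows "eval_trm A (\<lambda>i. gmul A (m i) (n i)) t = gmul A (eval_trm A m t) (eval_trm A n t)"
  using t
proof (induction t)
  case (App f ts)
  have A: "A \<in> Mod (arity ar) E" using A' by (auto simp: Mod_Un)
  then have cl: "closed_under (arity ar) A (carrier A)" by (simp add: Mod_def)
  have len: "length ts = arity ar f" using App.prems by simp
  \<comment> \<open>The variables of \<open>abelian_identities\<close> are interleaved: even ones
    receive the values of the arguments at \<open>m\<close>, odd ones the values at
    \<open>n\<close>. Past the arity, the unit is a filler that keeps the assignment inside the
    carrier.\<close>
  define \<rho> where "\<rho> k = (if k div 2 < length ts
    then eval_trm A (if even k then m else n) (ts ! (k div 2)) else gunit A)" for k
  have "\<rho> k \<in> carrier A" for k
    using eval_closed[OF cl m, of "ts ! (k div 2)"] eval_closed[OF cl n, of "ts ! (k div 2)"]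
      App.prems unit_law(1)[OF E A] by (auto simp: \<rho>_def)
  then have \<rho>: "range \<rho> \<subseteq> carrier A" by auto
  have "(App f (map (\<lambda>i. tmul (Var (2 * i)) (Var (2 * i + 1))) [0..<arity ar f]),
        tmul (App f (map (\<lambda>i. Var (2 * i)) [0..<arity ar f]))
           (App f (map (\<lambda>i. Var (2 * i + 1)) [0..<arity ar f]))) \<in> E \<union> abelian_identities ar"
    by (auto simp: abelian_identities_def)
  from Mod_identity[OF A' this \<rho>]
  have "interp A f (map (\<lambda>i. gmul A (\<rho> (2 * i)) (\<rho> (2 * i + 1))) [0..<length ts]) =
      gmul A (interp A f (map (\<lambda>i. \<rho> (2 * i)) [0..<length ts]))
        (interp A f (map (\<lambda>i. \<rho> (2 * i + 1)) [0..<length ts]))"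
    by (simp add: comp_def len)
  moreover have "map (\<lambda>i. gmul A (\<rho> (2 * i)) (\<rho> (2 * i + 1))) [0..<length ts] =
      map (eval_trm A (\<lambda>i. gmul A (m i) (n i))) ts"
    by (rule nth_equalityI) (use App in \<open>auto simp: \<rho>_def\<close>)
  moreover have "map (\<lambda>i. \<rho> (2 * i)) [0..<length ts] = map (eval_trm A m) ts"
    by (rule nth_equalityI) (auto simp: \<rho>_def)
  moreover have "map (\<lambda>i. \<rho> (2 * i + 1)) [0..<length ts] = map (eval_trm A n) ts"
    by (rule nth_equalityI) (auto simp: \<rho>_def)
  ultimately show ?case by simp
qed simp

lemma wf_abelian_identities:
  "\<forall>(s, t) \<in> abelian_identities ar. wf_trm (arity ar) s \<and> wf_trm (arity ar) t"
  by (auto simp: abelian_identities_def numeral_2_eq_2)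

text \<open>Doubling the variables turns the commutator word of \<open>f\<close> into a term
  \<open>v\<close>, even variables standing for the first tuple and odd ones for the second. Padding
  \<open>m\<close> and \<open>n\<close> with units at complementary places then recovers the given
  word as a commutator word of \<open>v\<close>.\<close>

lemma comm_word_in_W_comm_words:
  fixes A :: "('a, 'o gsym) algebra"
  assumes E: "Omega_group_variety ar E" and A: "A \<in> Mod (arity ar) E"
    and f: "wf_trm (arity ar) f"
    and M: "subalgebra (arity ar) A M" and N: "subalgebra (arity ar) A N"
    and m: "range m \<subseteq> M" and n: "range n \<subseteq> N"
  shows "\<exists>v m' n'. v \<in> W_terms ar (Ab ar E) \<and> range m' \<subseteq> M \<and> range n' \<subseteq> N \<and>
    comm_word A f m n = comm_word A v m' n'"
proof -
  let ?ar = "arity ar" and ?u = "\<lambda>_ :: nat. gunit A"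
  let ?x = "subst_trm (\<lambda>i. Var (2 * i)) f" and ?y = "subst_trm (\<lambda>i. Var (2 * i + 1)) f"
    and ?xy = "subst_trm (\<lambda>i. tmul (Var (2 * i)) (Var (2 * i + 1))) f"
  define v where "v = tmul (tmul ?xy (tinv ?y)) (tinv ?x)"
  \<comment> \<open>The supports of \<open>m'\<close> and \<open>n'\<close> are disjoint, so their
    entrywise product interleaves \<open>m\<close> and \<open>n\<close>.\<close>
  define m' where "m' k = (if even k then m (k div 2) else gunit A)" for k
  define n' where "n' k = (if odd k then n (k div 2) else gunit A)" for k
  \<comment> \<open>The element type of \<open>B\<close> is left free: the equation is needed both
    in the algebras of terms that test membership in \<open>W_terms\<close> and in
    \<open>A\<close>.\<close>
  have ev: "eval_trm B \<rho> v = comm_word B f (\<lambda>i. \<rho> (2 * i)) (\<lambda>i. \<rho> (2 * i + 1))"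
    for B :: "('b, 'o gsym) algebra" and \<rho>
    by (simp add: v_def comm_word_def eval_subst_trm)
  have wfv: "wf_trm ?ar v"
    by (auto simp: v_def numeral_2_eq_2 intro!: wf_subst_trm f)
  have "eval_trm B b v = gunit B" if "B \<in> Ab ar E" "range b \<subseteq> carrier B"
    for B :: "('o gsym trm, 'o gsym) algebra" and b
  proof -
    have B': "B \<in> Mod ?ar (E \<union> abelian_identities ar)" using that(1) Ab_eq_Mod[OF E] by blast
    then have B: "B \<in> Mod ?ar E" by (auto simp: Mod_Un)
    have r: "range (\<lambda>i. b (2 * i)) \<subseteq> carrier B" "range (\<lambda>i. b (2 * i + 1)) \<subseteq> carrier B"
      using that(2) by auto
    show ?thesis
      unfolding ev comm_word_eq_unit_iff[OF E B f r] by (rule eval_mul_abelian[OF E B' r f])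
  qed
  then have W: "v \<in> W_terms ar (Ab ar E)" using wfv by (simp add: W_terms_def)
  have uM: "gunit A \<in> S" if "subalgebra ?ar A S" for S
    using that by (simp add: subalgebra_def closed_under_def)
  have r: "range m' \<subseteq> M" "range n' \<subseteq> N"
    using m n uM[OF M] uM[OF N] by (auto simp: m'_def n'_def)
  have mA: "range m \<subseteq> carrier A" and nA: "range n \<subseteq> carrier A"
    using m n M N by (auto simp: subalgebra_def)
  note gl = group_laws[OF E A]
  have cl: "closed_under ?ar A (carrier A)" using A by (simp add: Mod_def)
  have em: "eval_trm A m f \<in> carrier A" and en: "eval_trm A n f \<in> carrier A"
    and emn: "eval_trm A (\<lambda>i. gmul A (m i) (n i)) f \<in> carrier A"
    using eval_closed[OF cl mA f] eval_closed[OF cl nA f]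
      eval_closed[OF cl _ f, of "\<lambda>i. gmul A (m i) (n i)"] gl(1) mA nA
    by (simp_all add: image_subset_iff)
  have mi: "m i \<in> carrier A" "n i \<in> carrier A" for i using mA nA by auto
  \<comment> \<open>Since \<open>f\<close> takes the value 1 at the unit tuple, its word is trivial
    as soon as one tuple is constantly 1. Hence \<open>v\<close> is 1 at \<open>m'\<close> and at
    \<open>n'\<close>, and only its value at their product survives in
    \<open>comm_word A v m' n'\<close>.\<close>
  have "comm_word A f m ?u = gunit A" "comm_word A f ?u n = gunit A"
    using mi em en
    by (simp_all add: comm_word_eq_unit_iff[OF E A f] mA nA unit_law(1)[OF E A]
        eval_unit[OF E A f] gl image_subset_iff)
  then have "eval_trm A m' v = gunit A" "eval_trm A n' v = gunit A"
    unfolding ev by (simp_all add: m'_def n'_def)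
  moreover have "eval_trm A (\<lambda>k. gmul A (m' k) (n' k)) v = comm_word A f m n"
    unfolding ev using mi by (simp add: m'_def n'_def gl)
  moreover have "comm_word A f m n \<in> carrier A"
    unfolding comm_word_def using em en emn gl(1,2) by simp
  moreover have "ginv A (gunit A) = gunit A"
    using gl(5)[OF gl(2)] gl(6) unit_law(1)[OF E A] by metis
  ultimately have "comm_word A v m' n' = comm_word A f m n"
    unfolding comm_word_def[of A v] by (simp add: gl)
  then show ?thesis using W r by metis
qed

text \<open>For a homomorphism \<open>h\<close> with kernel \<open>I\<close>, the assumption on
  commutator words says that every term is multiplicative on the image of \<open>K\<close>. For
  single operations these are the abelian identities, so \<open>v\<close> vanishes on that image.
  \<open>K\<close> will be the intersection of \<open>M\<close> and \<open>N\<close>.\<close>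

lemma W_Ab_eval_in_ideal:
  fixes A :: "('a, 'o gsym) algebra"
  assumes E: "Omega_group_variety ar E" and A: "A \<in> Mod (arity ar) E"
    and I: "Omega_ideal ar E A I" and K: "subalgebra (arity ar) A K"
    and comm: "\<And>f m n. \<lbrakk>wf_trm (arity ar) f; range m \<subseteq> K; range n \<subseteq> K\<rbrakk> \<Longrightarrow> comm_word A f m n \<in> I"
    and v: "v \<in> W_terms ar (Ab ar E)" and p: "range p \<subseteq> K"
  shows "eval_trm A p v \<in> I"
proof -
  let ?ar = "arity ar"
  obtain B :: "('a set, 'o gsym) algebra" and h
    where B: "B \<in> Mod ?ar E" and h: "h \<in> alg_hom ?ar A B" and I': "I = ker_hom A B h"
    using I unfolding Omega_ideal_def by blast
  let ?S = "restrict_alg B (h ` K)"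
  have sub: "subalgebra ?ar B (h ` K)" by (rule subalgebra_image[OF h K])
  have S: "?S \<in> Mod ?ar E" by (rule Mod_restrict_alg[OF B sub])
  have KA: "K \<subseteq> carrier A" and KB: "h ` K \<subseteq> carrier B"
    using K sub by (auto simp: subalgebra_def)
  have "eval_trm ?S \<rho> s = eval_trm ?S \<rho> t"
    if st: "(s, t) \<in> abelian_identities ar" and \<rho>: "range \<rho> \<subseteq> carrier ?S" for s t \<rho>
  proof -
    obtain f where s: "s = App f (map (\<lambda>i. tmul (Var (2 * i)) (Var (2 * i + 1))) [0..<?ar f])"
      and t: "t = tmul (App f (map (\<lambda>i. Var (2 * i)) [0..<?ar f]))
           (App f (map (\<lambda>i. Var (2 * i + 1)) [0..<?ar f]))"
      using st by (auto simp: abelian_identities_def)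
    have "\<forall>i. \<exists>x. x \<in> K \<and> \<rho> i = h x" using \<rho> by auto
    \<comment> \<open>The identity is pulled back to \<open>K\<close>: preimages are chosen for all
      variables, then split into the even and the odd ones to give the two tuples of a commutator
      word. The term \<open>?f\<close> below is the bare operation applied to distinct
      variables.\<close>
    then obtain \<sigma> where \<sigma>: "\<And>i. \<sigma> i \<in> K" "\<And>i. \<rho> i = h (\<sigma> i)" by metis
    let ?f = "App f (map Var [0..<?ar f])"
      and ?m = "\<lambda>i. \<sigma> (2 * i)" and ?n = "\<lambda>i. \<sigma> (2 * i + 1)"
    have wf: "wf_trm ?ar ?f" by auto
    have r: "range ?m \<subseteq> K" "range ?n \<subseteq> K" using \<sigma>(1) by auto
    then have rA: "range ?m \<subseteq> carrier A" "range ?n \<subseteq> carrier A" using KA by blast+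
    have rB: "range (\<lambda>i. h (?m i)) \<subseteq> carrier B" "range (\<lambda>i. h (?n i)) \<subseteq> carrier B"
      using r KB by blast+
    have "h (comm_word A ?f ?m ?n) = gunit B"
      using comm[OF wf r] I' by (simp add: ker_hom_def)
    then have "comm_word B ?f (\<lambda>i. h (?m i)) (\<lambda>i. h (?n i)) = gunit B"
      using hom_comm_word[OF E A h wf rA] by simp
    then show ?thesis
      unfolding comm_word_eq_unit_iff[OF E B wf rB] by (simp add: s t comp_def \<sigma>(2))
  qed
  then have S': "?S \<in> Mod ?ar (E \<union> abelian_identities ar)"
    using S by (auto simp: Mod_def)
  have wfE: "\<forall>(s, t) \<in> E \<union> abelian_identities ar. wf_trm ?ar s \<and> wf_trm ?ar t"
    using E wf_abelian_identities[of ar] by (auto simp: Omega_group_variety_def)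
  \<comment> \<open>\<open>W_terms\<close> only tests algebras whose elements are terms. With
    \<open>Ab\<close> written as a class of models, \<open>W_terms_universal\<close> transfers the
    vanishing of \<open>v\<close> to \<open>?S\<close>, whose elements are sets.\<close>
  have v': "v \<in> W_terms ar (Mod ?ar (E \<union> abelian_identities ar))"
    using v by (simp add: Ab_eq_Mod[OF E])
  have wfv: "wf_trm ?ar v" using v by (simp add: W_terms_def)
  have pA: "range p \<subseteq> carrier A" using p KA by blast
  have cl: "closed_under ?ar A (carrier A)" using A by (simp add: Mod_def)
  have "range (\<lambda>i. h (p i)) \<subseteq> carrier ?S" using p by auto
  from W_terms_universal[OF wfE v' S' this]
  have "h (eval_trm A p v) = gunit B"
    by (simp add: eval_hom[OF cl h pA wfv])
  then show ?thesis using eval_closed[OF cl pA wfv] by (simp add: I' ker_hom_def)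
qed

section \<open>Comparison of the two generated ideals\<close>

theorem proposition2p1:
  fixes ar :: "'o \<Rightarrow> nat"
    and E :: "('o gsym trm \<times> 'o gsym trm) set"
    and A :: "('a, 'o gsym) algebra"
    and M N :: "'a set"
  assumes "Omega_group_variety ar E"
    and "A \<in> Mod (arity ar) E"
    and "Omega_ideal ar E A M"
    and "Omega_ideal ar E A N"
  shows "relative_commutator ar E (Ab ar E) A M N = Higgins_commutator ar E A M N"
proof -
  let ?ar = "arity ar" and ?J = "join_alg ar A M N"
  note E = assms(1) and A = assms(2)
  define R where "R = {comm_word A v m n | v m n.
      v \<in> W_terms ar (Ab ar E) \<and> range m \<subseteq> M \<and> range n \<subseteq> N} \<union>
    {eval_trm A p v | v p. v \<in> W_terms ar (Ab ar E) \<and> range p \<subseteq> M \<inter> N}"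
  define H where "H = {comm_word A f m n | f m n. wf_trm ?ar f \<and> range m \<subseteq> M \<and> range n \<subseteq> N}"
  have M: "subalgebra ?ar A M" and N: "subalgebra ?ar A N"
    using assms(3,4) by (auto simp: Omega_ideal_def)
  have "closed_under ?ar A (carrier A)" using A by (simp add: Mod_def)
  \<comment> \<open>Both commutators are generated as ideals of the join, so the quotient argument
    takes place there and needs the join to lie in the variety.\<close>
  then have J: "?J \<in> Mod ?ar E"
    unfolding join_alg_def using M N
    by (intro Mod_restrict_alg[OF A] subalgebra_subalg_gen) (auto simp: subalgebra_def)
  have "M \<union> N \<subseteq> carrier ?J" by (auto simp: join_alg_def subalg_gen_def)
  then have K: "subalgebra ?ar ?J (M \<inter> N)"
    using M N by (auto simp: subalgebra_def closed_under_def join_alg_def)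
  have "H \<subseteq> R"
  proof
    fix x assume "x \<in> H"
    then obtain f m n where x: "x = comm_word A f m n"
      and f: "wf_trm ?ar f" "range m \<subseteq> M" "range n \<subseteq> N"
      unfolding H_def by blast
    obtain v m' n' where "v \<in> W_terms ar (Ab ar E)" "range m' \<subseteq> M" "range n' \<subseteq> N"
      "comm_word A f m n = comm_word A v m' n'"
      using comm_word_in_W_comm_words[OF E A f(1) M N f(2,3)] by metis
    then show "x \<in> R" unfolding R_def x by (intro UnI1) auto
  qed
  \<comment> \<open>Each generated ideal is an intersection of ideals of the join, so it is enough
    that the same ideals contain \<open>R\<close> and \<open>H\<close>.\<close>
  moreover have "R \<subseteq> I" if I: "Omega_ideal ar E ?J I" and HI: "H \<subseteq> I" for I
  proof -
    have c: "comm_word A f m n \<in> I" if "wf_trm ?ar f" "range m \<subseteq> M" "range n \<subseteq> N" for f m n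
      using that HI unfolding H_def by blast
    \<comment> \<open>Two tuples from the intersection are in particular one from \<open>M\<close>
      and one from \<open>N\<close>, so \<open>c\<close> supplies the required commutator
      words.\<close>
    have "eval_trm ?J p v \<in> I" if "v \<in> W_terms ar (Ab ar E)" "range p \<subseteq> M \<inter> N" for v p
      by (rule W_Ab_eval_in_ideal[OF E J I K _ that]) (simp add: c join_alg_def)
    then show ?thesis
      using c by (auto simp: R_def join_alg_def W_terms_def)
  qed
  ultimately have "ideal_gen ar E ?J R = ideal_gen ar E ?J H"
    unfolding ideal_gen_def by (intro arg_cong[of _ _ Inter]) blast
  then show ?thesis
    by (simp add: relative_commutator_def Higgins_commutator_def R_def H_def)
qed

end
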